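(* Let $q,z\in\mathbb{C}$ with $|q|<1$ and $z\ne0$. Then $$\sum_{n=0}^\infty(-1)^n\frac{(-1/z)_{n+1}(-zq,q)_n}{(q)_{2n+1}}q^{\binom{n+1}{2}}=\sum_{n=0}^\infty(-1)^nq^{n(n+1)}z^n-\sum_{n=-\infty}^{-1}(-1)^nq^{n(n+1)}z^n.$$
   Context: $(a)_n=(a;q)_n=\prod_{j=1}^{n}(1-aq^{j-1})$ for $n\ge0$ (with $(a)_0=1$), and $(a,b)_n=(a)_n(b)_n$. Here $(-1)^n$ is an ordinary power. *)

theory Defs
  imports "HOL-Analysis.Infinite_Sum"
begin

text \<open>The $q$-shifted factorial $(a;q)_n$.\<close>

definition qpoch :: "complex \<Rightarrow> complex \<Rightarrow> nat \<Rightarrow> complex" where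
  "qpoch a q n = (\<Prod>j=1..n. 1 - a * q ^ (j - 1))"

text \<open>The two-parameter version $(a,b;q)_n$.\<close>

definition qpoch2 :: "complex \<Rightarrow> complex \<Rightarrow> complex \<Rightarrow> nat \<Rightarrow> complex" where
  "qpoch2 a b q n = qpoch a q n * qpoch b q n"

end

theory Submission
  imports Defs "HOL-Analysis.Infinite_Products"
begin

text \<open>
  The finite Jacobi triple product expands the $n$-th summand on the left as
  $\sum_{k\le n} b_k\,t_k(n-k)$ with $b_k = (-1)^k q^{k(k+1)}(z^k + z^{-1-k})$ and
  $t_k(m) = (-1)^m q^{km+\binom{m+1}{2}} (q)_{k+m} / ((q)_{2k+1+m}(q)_m)$. Since $\sum_m t_k(m) = 1$
  (an instance of the ${}_1\phi_1$ summation, obtained here by showing that the sum is independent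
  of $k$ and evaluating it at $k=0$), summing over $n$ first leaves $\sum_k b_k$, which is
  the right-hand side. The interchange is Tannery's theorem, as $|t_k(m)| \le C|q|^m$.
\<close>

section \<open>Finite q-factorials inside the unit disc: nonvanishing and limit\<close>

lemma qpoch_0 [simp]: "qpoch a q 0 = 1"
  by (simp add: qpoch_def)

lemma qpoch_Suc: "qpoch a q (Suc n) = qpoch a q n * (1 - a * q ^ n)"
  by (simp add: qpoch_def)

lemma qpoch_self_Suc: "qpoch q q (Suc n) = qpoch q q n * (1 - q ^ Suc n)"
  by (simp add: qpoch_Suc)

lemma one_minus_power_nonzero:
  fixes q :: complex
  assumes "norm q < 1" "n > 0"
  shows "1 - q ^ n \<noteq> 0"
proof
  assume "1 - q ^ n = 0"
  then have "norm (q ^ n) = 1" by simp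
  moreover have "norm q ^ n < 1" using assms by (simp add: power_less_one_iff)
  ultimately show False by (simp add: norm_power)
qed

lemma qpoch_self_nonzero:
  assumes "norm q < 1"
  shows "qpoch q q n \<noteq> 0"
proof (induction n)
  case (Suc n)
  then show ?case
    using one_minus_power_nonzero[OF assms, of "Suc n"] by (simp add: qpoch_self_Suc del: power_Suc)
qed simp

lemma qpoch_zero_base: "qpoch 0 0 n = 1"
  by (simp add: qpoch_def)

text \<open>The series of |q|^(i+1) converges and no factor 1 - q^(i+1) vanishes, so the infinite
  product is nonzero. That the limit is nonzero is what later bounds the reciprocals of
  (q)_n.\<close>

lemma qpoch_self_tendsto:
  assumes "norm q < 1"
  obtains L where "qpoch q q \<longlonglongrightarrow> L" "L \<noteq> 0"
proof -
  let ?f = "\<lambda>i. 1 - q ^ Suc i"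
  have "summable (\<lambda>i. norm (?f i - 1))"
    using assms by (simp add: norm_power norm_mult summable_geometric summable_mult)
  then have "convergent_prod ?f"
    by (intro abs_convergent_prod_imp_convergent_prod summable_imp_abs_convergent_prod)
  then obtain L where L: "(\<lambda>n. \<Prod>i\<le>n. ?f i) \<longlonglongrightarrow> L" "L \<noteq> 0"
    using convergent_prod_iff_nz_lim[of ?f] one_minus_power_nonzero[OF assms] by blast
  have "(\<Prod>i\<le>n. ?f i) = qpoch q q (Suc n)" for n
    by (induction n) (simp_all add: qpoch_Suc)
  with L show ?thesis
    by (intro that[of L]) (simp_all add: filterlim_sequentially_Suc)
qed

section \<open>Finite Jacobi triple product\<close>

text \<open>
  With $1/(q)_j = 0$ for $j < 0$ the recurrence $1/(q)_{j-1} = (1-q^j)/(q)_j$ holds for every integer $j$,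
  so the induction for the triple product needs no boundary cases.
\<close>

definition recip_qfact :: "complex \<Rightarrow> int \<Rightarrow> complex" where
  "recip_qfact q j = (if j < 0 then 0 else 1 / qpoch q q (nat j))"

lemma recip_qfact_neg [simp]: "j < 0 \<Longrightarrow> recip_qfact q j = 0"
  by (simp add: recip_qfact_def)

lemma recip_qfact_of_nat [simp]: "recip_qfact q (int n) = 1 / qpoch q q n"
  by (simp add: recip_qfact_def)

lemma recip_qfact_rec:
  assumes "norm q < 1"
  shows "recip_qfact q (j - 1) = (1 - q powi j) * recip_qfact q j"
proof (cases "j > 0")
  case True
  then obtain n where j: "j = int (Suc n)"
    by (metis Suc_pred zero_less_imp_eq_int)
  have p: "q powi j = q ^ Suc n"
    unfolding j by (rule power_int_of_nat)
  show ?thesis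
    unfolding p
    using qpoch_self_nonzero[OF assms, of n] one_minus_power_nonzero[OF assms, of "Suc n"]
    by (simp add: j recip_qfact_def qpoch_self_Suc nat_add_distrib del: power_Suc)
next
  case False
  then show ?thesis by (cases "j = 0") simp_all
qed

text \<open>The terms of index j = k and j = -1-k of the bilateral theta series with terms
  q^(j(j+1)/2) z^j. The exponent of q is invariant under j -> -1-j, so one power of q serves
  both.\<close>

definition theta_term :: "complex \<Rightarrow> complex \<Rightarrow> nat \<Rightarrow> complex" where
  "theta_term q z k = q ^ (Suc k choose 2) * (z ^ k + inverse z ^ Suc k)"

lemma choose_two_Suc: "Suc n choose 2 = n + (n choose 2)"
  by (simp add: numeral_2_eq_2)

lemma theta_term_0: "theta_term q z 0 = 1 + inverse z"
  by (simp add: theta_term_def binomial_eq_0)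

lemma theta_term_shift_0:
  assumes "q \<noteq> 0" "z \<noteq> 0"
  shows "(z + 1 / z) * theta_term q z 0 = theta_term q z 1 / q + theta_term q z 0"
  using assms by (simp add: theta_term_def choose_two_Suc field_simps power2_eq_square)

text \<open>Multiplying by z + 1/z moves each index j of the theta series to j+1 and j-1; the powers
  of q correct for the change in j(j+1)/2. For k = 0 the lower neighbour -1 lies in the same pair as
  0, which is why \<open>theta_term_shift_0\<close> is separate.\<close>

lemma theta_term_shift:
  assumes "q \<noteq> 0" "z \<noteq> 0"
  shows "(z + 1 / z) * theta_term q z (Suc k)
    = theta_term q z (Suc (Suc k)) / q ^ Suc (Suc k) + q ^ Suc k * theta_term q z k"
proof -
  have 1: "theta_term q z (Suc (Suc k)) / q ^ Suc (Suc k)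
      = q ^ (Suc (Suc k) choose 2) * (z ^ Suc (Suc k) + inverse z ^ Suc (Suc (Suc k)))"
    unfolding theta_term_def choose_two_Suc[of "Suc (Suc k)"] power_add using assms(1)
    by (simp del: power_Suc)
  have 2: "q ^ Suc k * theta_term q z k
      = q ^ (Suc (Suc k) choose 2) * (z ^ k + inverse z ^ Suc k)"
    unfolding theta_term_def choose_two_Suc[of "Suc k"] power_add by (simp only: mult_ac)
  have 3: "(z + 1 / z) * (z ^ Suc k + inverse z ^ Suc (Suc k))
      = (z ^ Suc (Suc k) + inverse z ^ Suc (Suc (Suc k))) + (z ^ k + inverse z ^ Suc k)"
    using assms(2) by (simp add: field_simps)
  show ?thesis
    unfolding 1 2 unfolding theta_term_def distrib_left[symmetric] 3[symmetric] by (simp only: mult_ac)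
qed

text \<open>Summation by parts: multiplication by z + 1/z is transferred to the coefficients. The
  symmetry of c absorbs the exceptional pair k = 0, and the last two terms are what is left at the
  upper end.\<close>

lemma theta_sum_shift:
  fixes c :: "int \<Rightarrow> complex"
  assumes "q \<noteq> 0" "z \<noteq> 0" and sym: "c (-1) = c 0"
  shows "(z + 1 / z) * (\<Sum>k\<le>N. c (int k) * theta_term q z k)
    = (\<Sum>k\<le>N. (c (int k - 1) / q ^ k + q ^ Suc k * c (int k + 1)) * theta_term q z k)
      + c (int N) * theta_term q z (Suc N) / q ^ Suc N - c (int N + 1) * q ^ Suc N * theta_term q z N"
proof (induction N)
  case 0
  have "(z + 1 / z) * (c 0 * theta_term q z 0) = c 0 * (theta_term q z 1 / q + theta_term q z 0)"
    unfolding theta_term_shift_0[OF assms(1,2), symmetric] by (simp only: mult_ac)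
  then show ?case using sym by (simp add: algebra_simps)
next
  case (Suc N)
  have "(z + 1 / z) * (c (int (Suc N)) * theta_term q z (Suc N))
     = c (int (Suc N)) * (theta_term q z (Suc (Suc N)) / q ^ Suc (Suc N) + q ^ Suc N * theta_term q z N)"
    unfolding theta_term_shift[OF assms(1,2), symmetric] by (simp only: mult_ac)
  with Suc show ?case
    by (simp add: algebra_simps del: power_Suc)
qed

text \<open>Times (q)_(2n+1), this is the q-binomial coefficient of 2n+1 over n-k. It is symmetric
  under k -> -1-k and vanishes for k > n.\<close>

definition jacobi_coeff :: "complex \<Rightarrow> nat \<Rightarrow> int \<Rightarrow> complex" where
  "jacobi_coeff q n k = recip_qfact q (int n + 1 + k) * recip_qfact q (int n - k)"

text \<open>Drives the induction on n: with X = q^(n+1), the numerator gains (1 + X/z)(1 + zX) = 1 +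
  X^2 + X(z + 1/z), and the last bracket is the effect of z + 1/z found in
  \<open>theta_sum_shift\<close>.\<close>

lemma jacobi_coeff_rec:
  assumes "norm q < 1" "q \<noteq> 0"
  shows "(1 - q ^ (2 * n + 2)) * (1 - q ^ (2 * n + 3)) * jacobi_coeff q (Suc n) (int k)
    = (1 + q ^ (2 * n + 2)) * jacobi_coeff q n (int k)
      + q ^ Suc n * (jacobi_coeff q n (int k - 1) / q ^ k + q ^ Suc k * jacobi_coeff q n (int k + 1))"
proof -
  define X where "X = q ^ Suc n"
  define Y where "Y = q ^ k"
  have Y: "Y \<noteq> 0" using assms(2) by (simp add: Y_def)
  \<comment> \<open>These two reciprocals have the largest arguments that occur, so
    \<open>recip_qfact_rec\<close> expresses all the others through them and the claim becomes a
    rational identity in q, X and Y.\<close>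
  define a where "a = recip_qfact q (int n + 2 + int k)"
  define b where "b = recip_qfact q (int n + 1 - int k)"
  have pX: "q powi (int n + 1) = X"
    unfolding X_def by (metis power_int_of_nat of_nat_Suc add.commute)
  have pXY: "q powi (int n + 1 + int k) = X * Y"
    using assms(2) by (simp add: power_int_add pX[symmetric] Y_def)
  have pqXY: "q powi (int n + 2 + int k) = q * X * Y"
    using assms(2) by (simp add: power_int_add pX[symmetric] Y_def power2_eq_square)
  have pXdY: "q powi (int n + 1 - int k) = X / Y"
    using assms(2) by (simp add: power_int_diff pX Y_def)
  have pXdqY: "q powi (int n - int k) = X / (q * Y)"
    using assms(2) by (simp add: power_int_diff X_def Y_def)
  have r1: "recip_qfact q (int n + 1 + int k) = (1 - q * X * Y) * a"
    using recip_qfact_rec[OF assms(1), of "int n + 2 + int k"] unfolding pqXY a_def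
    by (simp add: algebra_simps)
  have r2: "recip_qfact q (int n + int k) = (1 - X * Y) * ((1 - q * X * Y) * a)"
    using recip_qfact_rec[OF assms(1), of "int n + 1 + int k"] unfolding pXY r1
    by (simp add: algebra_simps)
  have r3: "recip_qfact q (int n - int k) = (1 - X / Y) * b"
    using recip_qfact_rec[OF assms(1), of "int n + 1 - int k"] unfolding pXdY b_def
    by (simp add: algebra_simps)
  have r4: "recip_qfact q (int n - int k - 1) = (1 - X / (q * Y)) * ((1 - X / Y) * b)"
    using recip_qfact_rec[OF assms(1), of "int n - int k"] unfolding pXdqY r3 .
  have j0: "jacobi_coeff q (Suc n) (int k) = a * b"
    unfolding jacobi_coeff_def a_def b_def by (simp add: algebra_simps)
  have j1: "jacobi_coeff q n (int k) = (1 - q * X * Y) * a * ((1 - X / Y) * b)"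
    unfolding jacobi_coeff_def r1 r3 ..
  have e: "int n + 1 + (int k - 1) = int n + int k" "int n - (int k - 1) = int n + 1 - int k"
     "int n + 1 + (int k + 1) = int n + 2 + int k" "int n - (int k + 1) = int n - int k - 1"
    by simp_all
  have j2: "jacobi_coeff q n (int k - 1) = (1 - X * Y) * ((1 - q * X * Y) * a) * b"
    unfolding jacobi_coeff_def e r2 b_def[symmetric] ..
  have j3: "jacobi_coeff q n (int k + 1) = a * ((1 - X / (q * Y)) * ((1 - X / Y) * b))"
    unfolding jacobi_coeff_def e r4 a_def[symmetric] ..
  have X2: "q ^ (2 * n + 2) = X * X" "q ^ (2 * n + 3) = q * X * X"
    by (simp_all add: X_def power_add mult_2 eval_nat_numeral)
  have "(1 - X * X) * (1 - q * X * X) * (a * b)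
     = (1 + X * X) * ((1 - q * X * Y) * a * ((1 - X / Y) * b))
       + X * ((1 - X * Y) * ((1 - q * X * Y) * a) * b / Y
         + q * Y * (a * ((1 - X / (q * Y)) * ((1 - X / Y) * b))))"
    using Y assms(2) by (simp add: field_simps)
  then show ?thesis
    unfolding j0 j1 j2 j3 X2 power_Suc[of q k] X_def[symmetric] Y_def[symmetric] .
qed

lemma finite_jacobi_aux:
  assumes "norm q < 1" "q \<noteq> 0" "z \<noteq> 0"
  shows "qpoch (-1 / z) q (n + 1) * qpoch (-z * q) q n / qpoch q q (2 * n + 1)
    = (\<Sum>k\<le>n. jacobi_coeff q n (int k) * theta_term q z k)"
proof (induction n)
  case 0
  have "recip_qfact q 1 = 1 / (1 - q)" "recip_qfact q 0 = 1"
    using recip_qfact_of_nat[of q 1] recip_qfact_of_nat[of q 0] by (simp_all add: qpoch_Suc)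
  then show ?case
    by (simp add: jacobi_coeff_def theta_term_0 qpoch_Suc divide_inverse)
next
  case (Suc n)
  let ?P = "\<lambda>n. qpoch (-1 / z) q (n + 1) * qpoch (-z * q) q n / qpoch q q (2 * n + 1)"
  let ?D = "(1 - q ^ (2 * n + 2)) * (1 - q ^ (2 * n + 3))"
  have D: "?D \<noteq> 0"
    using one_minus_power_nonzero[OF assms(1), of "2 * n + 2"]
      one_minus_power_nonzero[OF assms(1), of "2 * n + 3"] by (simp only: mult_eq_0_iff) simp
  define X where "X = q ^ Suc n"
  have X2: "q ^ (2 * n + 2) = X * X"
    by (simp add: X_def power_add mult_2 eval_nat_numeral)
  have "qpoch (-1 / z) q (Suc n + 1) = qpoch (-1 / z) q (n + 1) * (1 + X / z)"
    by (simp add: qpoch_Suc X_def)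
  moreover have "qpoch (-z * q) q (Suc n) = qpoch (-z * q) q n * (1 + z * X)"
    by (simp add: qpoch_Suc X_def)
  moreover have "qpoch q q (2 * Suc n + 1) = qpoch q q (2 * n + 1) * ?D"
    by (simp add: qpoch_self_Suc eval_nat_numeral)
  ultimately have "?D * ?P (Suc n) = ?P n * ((1 + X / z) * (1 + z * X))"
    using D by (simp only: times_divide_eq_left times_divide_eq_right) (simp add: mult_ac)
  also have "(1 + X / z) * (1 + z * X) = 1 + q ^ (2 * n + 2) + X * (z + 1 / z)"
    using assms(3) unfolding X2 by (simp add: field_simps)
  \<comment> \<open>The added term k = n+1 is zero. Extending the range now matches the target sum
    and makes both boundary terms of \<open>theta_sum_shift\<close> vanish.\<close>
  also have "?P n = (\<Sum>k\<le>Suc n. jacobi_coeff q n (int k) * theta_term q z k)"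
    unfolding Suc by (simp add: jacobi_coeff_def)
  also have "\<dots> * (1 + q ^ (2 * n + 2) + X * (z + 1 / z))
      = (\<Sum>k\<le>Suc n. (1 + q ^ (2 * n + 2)) * jacobi_coeff q n (int k) * theta_term q z k)
        + X * ((z + 1 / z) * (\<Sum>k\<le>Suc n. jacobi_coeff q n (int k) * theta_term q z k))"
    by (simp only: ring_distribs sum_distrib_left sum_distrib_right sum.distrib mult_ac)
  also have "(z + 1 / z) * (\<Sum>k\<le>Suc n. jacobi_coeff q n (int k) * theta_term q z k)
     = (\<Sum>k\<le>Suc n. (jacobi_coeff q n (int k - 1) / q ^ k + q ^ Suc k * jacobi_coeff q n (int k + 1))
          * theta_term q z k)"
  proof -
    have "jacobi_coeff q n (-1) = jacobi_coeff q n 0"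
      by (simp add: jacobi_coeff_def mult.commute add.commute)
    moreover have "jacobi_coeff q n (int (Suc n)) = 0" "jacobi_coeff q n (int (Suc n) + 1) = 0"
      by (simp_all add: jacobi_coeff_def)
    ultimately show ?thesis
      using theta_sum_shift[OF assms(2,3), of "jacobi_coeff q n" "Suc n"] by simp
  qed
  also have "(\<Sum>k\<le>Suc n. (1 + q ^ (2 * n + 2)) * jacobi_coeff q n (int k) * theta_term q z k) + X * \<dots>
     = (\<Sum>k\<le>Suc n. ?D * jacobi_coeff q (Suc n) (int k) * theta_term q z k)"
    unfolding jacobi_coeff_rec[OF assms(1,2)] X_def
    by (simp only: ring_distribs sum_distrib_left sum.distrib mult_ac)
  also have "\<dots> = ?D * (\<Sum>k\<le>Suc n. jacobi_coeff q (Suc n) (int k) * theta_term q z k)"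
    by (simp only: sum_distrib_left mult_ac)
  finally show ?case by (rule mult_left_cancel[OF D, THEN iffD1])
qed

text \<open>The finite form of Jacobi's triple product, with the terms of index $k$ and $-1-k$ paired.\<close>

lemma finite_jacobi:
  assumes "norm q < 1" "z \<noteq> 0"
  shows "qpoch (-1 / z) q (n + 1) * qpoch (-z * q) q n / qpoch q q (2 * n + 1)
    = (\<Sum>k\<le>n. theta_term q z k / (qpoch q q (n + 1 + k) * qpoch q q (n - k)))"
proof (cases "q = 0")
  \<comment> \<open>The recurrences divide by powers of q, so q = 0 is checked directly; only the
    term k = 0 survives.\<close>
  case True
  have "theta_term 0 z k = 0" if "k > 0" for k
    using that by (cases k) (simp_all add: theta_term_def choose_two_Suc)
  then have "(\<Sum>k\<le>n. theta_term 0 z k) = theta_term 0 z 0"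
    by (simp add: sum.atMost_shift)
  moreover have "qpoch a 0 (Suc m) = 1 - a" for a m
    by (induction m) (simp_all add: qpoch_Suc)
  ultimately show ?thesis
    using True by (simp add: qpoch_zero_base theta_term_0 divide_inverse)
next
  case False
  have "jacobi_coeff q n (int k) = 1 / (qpoch q q (n + 1 + k) * qpoch q q (n - k))" if "k \<le> n" for k
  proof -
    have "int n + 1 + int k = int (n + 1 + k)" "int n - int k = int (n - k)"
      using that by simp_all
    then show ?thesis unfolding jacobi_coeff_def by (simp only: recip_qfact_of_nat) simp
  qed
  then show ?thesis
    unfolding finite_jacobi_aux[OF assms(1) False assms(2)] by (intro sum.cong) auto
qed

section \<open>Expansion of the summand into theta coefficients and a kernel\<close>

text \<open>The t_k(m) of the overview: what remains of the k-th term of the summand n = k + m once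
  b_k is split off.\<close>

definition theta_kernel :: "complex \<Rightarrow> nat \<Rightarrow> nat \<Rightarrow> complex" where
  "theta_kernel q k m = (-1) ^ m * q ^ (k * m + (Suc m choose 2)) * qpoch q q (k + m)
     / (qpoch q q (2 * k + 1 + m) * qpoch q q m)"

lemma choose_two_add: "Suc (k + m) choose 2 = (Suc k choose 2) + k * m + (Suc m choose 2)"
  by (induction m) (simp_all add: choose_two_Suc numeral_2_eq_2)

lemma double_choose_two: "2 * (Suc k choose 2) = k * (k + 1)"
  by (induction k) (simp_all add: choose_two_Suc)

lemma summand_eq:
  assumes "norm q < 1" "z \<noteq> 0"
  shows "(-1) ^ n * (qpoch (-1 / z) q (n + 1) * qpoch2 (-z * q) q q n
             / qpoch q q (2 * n + 1)) * q ^ ((n + 1) choose 2)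
     = (\<Sum>k\<le>n. (-1) ^ k * q ^ (k * (k + 1)) * (z ^ k + inverse z ^ Suc k) * theta_kernel q k (n - k))"
proof -
  have "(-1) ^ n * (qpoch (-1 / z) q (n + 1) * qpoch2 (-z * q) q q n
             / qpoch q q (2 * n + 1)) * q ^ ((n + 1) choose 2)
     = (-1) ^ n * q ^ (Suc n choose 2) * qpoch q q n *
        (qpoch (-1 / z) q (n + 1) * qpoch (-z * q) q n / qpoch q q (2 * n + 1))"
    by (simp add: qpoch2_def)
  also have "\<dots> = (\<Sum>k\<le>n. (-1) ^ n * q ^ (Suc n choose 2) * qpoch q q n *
      (theta_term q z k / (qpoch q q (n + 1 + k) * qpoch q q (n - k))))"
    unfolding finite_jacobi[OF assms] by (simp only: sum_distrib_left)
  also have "\<dots> = (\<Sum>k\<le>n. (-1) ^ k * q ^ (k * (k + 1)) * (z ^ k + inverse z ^ Suc k) * theta_kernel q k (n - k))"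
  proof (intro sum.cong refl)
    fix k assume "k \<in> {..n}"
    then obtain m where n: "n = k + m" by (auto simp: le_iff_add)
    \<comment> \<open>C(n+1,2) contains one copy of C(k+1,2) and the theta term contributes another;
      together they give the exponent k(k+1) of b_k.\<close>
    have p: "q ^ (Suc n choose 2) * q ^ (Suc k choose 2)
       = q ^ (k * (k + 1)) * q ^ (k * m + (Suc m choose 2))"
      unfolding power_add[symmetric] n choose_two_add
      using double_choose_two[of k] by (intro arg_cong[of _ _ "power q"]) linarith
    have i: "n - k = m" "n + 1 + k = 2 * k + 1 + m" by (simp_all add: n)
    have "(-1) ^ n * q ^ (Suc n choose 2) * qpoch q q n *
      (theta_term q z k / (qpoch q q (n + 1 + k) * qpoch q q (n - k)))
      = (-1) ^ k * (-1) ^ m * (q ^ (Suc n choose 2) * q ^ (Suc k choose 2))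
        * (z ^ k + inverse z ^ Suc k) * qpoch q q (k + m)
        / (qpoch q q (2 * k + 1 + m) * qpoch q q m)"
      unfolding i theta_term_def by (simp add: n power_add)
    also have "\<dots> = (-1) ^ k * q ^ (k * (k + 1)) * (z ^ k + inverse z ^ Suc k) * theta_kernel q k (n - k)"
      unfolding p theta_kernel_def i by (simp del: power_Suc)
    finally show "(-1) ^ n * q ^ (Suc n choose 2) * qpoch q q n *
      (theta_term q z k / (qpoch q q (n + 1 + k) * qpoch q q (n - k)))
      = (-1) ^ k * q ^ (k * (k + 1)) * (z ^ k + inverse z ^ Suc k) * theta_kernel q k (n - k)" .
  qed
  finally show ?thesis .
qed


section \<open>The kernel sums to 1 for every k\<close>

text \<open>At k = 0 the factor (q)_m cancels, leaving (-1)^m q^C(m+1,2) / (q)_(m+1). This is E_m -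
  E_(m+1) with E_m = (-1)^m q^C(m+1,2) / (q)_m, so the sum telescopes.\<close>

lemma theta_kernel_0_partial_sum:
  assumes "norm q < 1"
  shows "(\<Sum>m<M. theta_kernel q 0 m) = 1 - (-1) ^ M * q ^ (Suc M choose 2) / qpoch q q M"
proof (induction M)
  case 0
  then show ?case by (simp add: binomial_eq_0)
next
  case (Suc M)
  have nz: "qpoch q q M \<noteq> 0" "1 - q * q ^ M \<noteq> 0"
    using qpoch_self_nonzero[OF assms] one_minus_power_nonzero[OF assms, of "Suc M"] by simp_all
  have kernel: "theta_kernel q 0 M = (-1) ^ M * q ^ (Suc M choose 2) / qpoch q q (Suc M)"
    using nz by (simp add: theta_kernel_def)
  have recip: "1 / qpoch q q M = (1 - q * q ^ M) / qpoch q q (Suc M)"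
    using nz by (simp add: qpoch_Suc)
  have pow: "q ^ (Suc (Suc M) choose 2) = q * q ^ M * q ^ (Suc M choose 2)"
    by (subst choose_two_Suc) (simp add: power_add)
  have IH: "(\<Sum>m<M. theta_kernel q 0 m) = 1 - (-1) ^ M * q ^ (Suc M choose 2) * (1 / qpoch q q M)"
    using Suc by simp
  show ?case
    unfolding sum.lessThan_Suc IH kernel recip pow
    by (simp add: algebra_simps diff_divide_distrib)
qed

lemma theta_kernel_rec_m:
  assumes "norm q < 1"
  shows "(1 - q ^ (2 * k + 2 + m)) * (1 - q ^ Suc m) * theta_kernel q k (Suc m)
    = - (q ^ (k + m + 1) * (1 - q ^ (k + m + 1)) * theta_kernel q k m)"
proof -
  have nz: "1 - q ^ (2 * k + 2 + m) \<noteq> 0" "1 - q ^ Suc m \<noteq> 0"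
    using one_minus_power_nonzero[OF assms, of "2 * k + 2 + m"]
      one_minus_power_nonzero[OF assms, of "Suc m"] by auto
  have "2 * k + 1 + Suc m = Suc (2 * k + 1 + m)" by simp
  then have "theta_kernel q k (Suc m) = (-1) ^ Suc m * q ^ (k * Suc m + (Suc (Suc m) choose 2))
      * (qpoch q q (k + m) * (1 - q ^ (k + m + 1)))
      / ((qpoch q q (2 * k + 1 + m) * (1 - q ^ (2 * k + 2 + m))) * (qpoch q q m * (1 - q ^ Suc m)))"
    by (simp add: theta_kernel_def qpoch_self_Suc del: power_Suc mult_Suc_right)
  moreover have "q ^ (k * Suc m + (Suc (Suc m) choose 2))
      = q ^ (k * m + (Suc m choose 2)) * q ^ (k + m + 1)"
    unfolding power_add[symmetric] choose_two_Suc[of "Suc m"] by (simp add: algebra_simps)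
  ultimately show ?thesis
    using nz by (simp add: theta_kernel_def power_Suc[of "-1"] del: power_Suc)
qed

text \<open>The pairs (k+1, m) and (k, m+1) are compared because both kernels contain (q)_(k+m+1).
  This offset is why the sum for k has one more term in
  \<open>theta_kernel_telescope\<close>.\<close>

lemma theta_kernel_rec_k:
  assumes "norm q < 1"
  shows "(1 - q ^ (2 * k + 3 + m)) * (q ^ Suc k * theta_kernel q (Suc k) m)
    = - ((1 - q ^ Suc m) * theta_kernel q k (Suc m))"
proof -
  have nz: "1 - q ^ (2 * k + 3 + m) \<noteq> 0" "1 - q ^ Suc m \<noteq> 0"
    using one_minus_power_nonzero[OF assms, of "2 * k + 3 + m"]
      one_minus_power_nonzero[OF assms, of "Suc m"] by auto
  have i: "2 * Suc k + 1 + m = Suc (2 * k + 1 + Suc m)" by simp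
  have p: "q ^ (k * Suc m + (Suc (Suc m) choose 2)) = q ^ Suc k * q ^ (Suc k * m + (Suc m choose 2))"
    unfolding power_add[symmetric] choose_two_Suc[of "Suc m"] by (simp add: algebra_simps)
  have "theta_kernel q (Suc k) m = (-1) ^ m * q ^ (Suc k * m + (Suc m choose 2)) * qpoch q q (k + Suc m)
      / ((qpoch q q (2 * k + 1 + Suc m) * (1 - q ^ (2 * k + 3 + m))) * qpoch q q m)"
    unfolding theta_kernel_def i qpoch_self_Suc[of q "2 * k + 1 + Suc m"]
    by (simp add: eval_nat_numeral del: power_Suc)
  moreover have "theta_kernel q k (Suc m)
      = - ((-1) ^ m * (q ^ Suc k * q ^ (Suc k * m + (Suc m choose 2))) * qpoch q q (k + Suc m))
      / (qpoch q q (2 * k + 1 + Suc m) * (qpoch q q m * (1 - q ^ Suc m)))"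
    unfolding theta_kernel_def p qpoch_self_Suc[of q m] by simp
  ultimately show ?thesis
    using nz by (simp del: power_Suc)
qed

text \<open>Independence of $\sum_m t_k(m)$ from $k$: the right-hand side is a certificate of $q$-Zeilberger type.\<close>

lemma theta_kernel_telescope:
  assumes "norm q < 1"
  shows "q ^ Suc k * ((\<Sum>m<M. theta_kernel q (Suc k) m) - (\<Sum>m<Suc M. theta_kernel q k m))
    = (1 + q ^ Suc k) * ((1 - q ^ Suc M) * theta_kernel q k (Suc M))"
proof (induction M)
  \<comment> \<open>The left side is just -K t_k(0). The recurrence in m at m = 0 yields it after
    cancelling 1 - K from 1 - K^2 = (1 - K)(1 + K).\<close>
  case 0
  define K where "K = q ^ Suc k"
  have K: "1 - K \<noteq> 0"
    using one_minus_power_nonzero[OF assms, of "Suc k"] by (simp add: K_def)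
  have "q ^ (2 * k + 2 + 0) = K * K" "q ^ (k + 0 + 1) = K"
    by (simp_all add: K_def mult_2 power_add)
  then have "(1 - K * K) * (1 - q) * theta_kernel q k 1 = - (K * (1 - K) * theta_kernel q k 0)"
    using theta_kernel_rec_m[OF assms, of k 0] by simp
  then have "(1 - K) * ((1 + K) * ((1 - q) * theta_kernel q k 1)) = (1 - K) * (- (K * theta_kernel q k 0))"
    by (simp add: algebra_simps)
  then have "(1 + K) * ((1 - q) * theta_kernel q k 1) = - (K * theta_kernel q k 0)"
    using K by (metis mult_left_cancel)
  then show ?case by (simp add: K_def)
next
  case (Suc M)
  define K where "K = q ^ Suc k"
  define X where "X = q ^ Suc M"
  define D where "D = 1 - K * K * X"
  define u where "u = theta_kernel q k (Suc M)"
  define v where "v = theta_kernel q k (Suc (Suc M))"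
  define w where "w = theta_kernel q (Suc k) M"
  have p: "q ^ (2 * k + 3 + M) = K * K * X" "q ^ (2 * k + 2 + Suc M) = K * K * X"
     "q ^ (k + Suc M + 1) = K * X" "q ^ Suc (Suc M) = q * X"
    by (simp_all add: K_def X_def mult_2 power_add eval_nat_numeral)
  have D: "D \<noteq> 0"
    using one_minus_power_nonzero[OF assms, of "2 * k + 3 + M"] by (simp add: p(1) D_def)
  have w: "D * (K * w) = - ((1 - X) * u)"
    using theta_kernel_rec_k[OF assms, of k M] unfolding p(1)
    by (simp only: D_def w_def u_def K_def X_def)
  have v: "D * ((1 - q * X) * v) = - (K * X * (1 - K * X) * u)"
    using theta_kernel_rec_m[OF assms, of k "Suc M"] unfolding p
    by (simp only: D_def v_def u_def mult.assoc)
  \<comment> \<open>D is the leading factor in both recurrences. Multiplying by it turns w and v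
    into multiples of u, and a polynomial identity in K and X remains.\<close>
  have "D * (K * w - K * u) = D * ((1 + K) * ((1 - q * X) * v - (1 - X) * u))"
  proof -
    have "D * (K * w - K * u) = - ((1 - X) * u) - D * K * u"
      by (simp only: right_diff_distrib w mult.assoc)
    also have "\<dots> = (1 + K) * (- (K * X * (1 - K * X) * u) - D * ((1 - X) * u))"
      unfolding D_def by (simp add: algebra_simps)
    also have "\<dots> = D * ((1 + K) * ((1 - q * X) * v - (1 - X) * u))"
      unfolding v[symmetric] by (simp only: right_diff_distrib mult_ac)
    finally show ?thesis .
  qed
  then have "K * w - K * u = (1 + K) * ((1 - q * X) * v - (1 - X) * u)"
    using D by (metis mult_left_cancel)
  moreover have "K * ((\<Sum>m<Suc M. theta_kernel q (Suc k) m) - (\<Sum>m<Suc (Suc M). theta_kernel q k m))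
      = K * ((\<Sum>m<M. theta_kernel q (Suc k) m) - (\<Sum>m<Suc M. theta_kernel q k m)) + (K * w - K * u)"
    by (simp add: u_def w_def algebra_simps)
  moreover have "K * ((\<Sum>m<M. theta_kernel q (Suc k) m) - (\<Sum>m<Suc M. theta_kernel q k m))
      = (1 + K) * ((1 - X) * u)"
    using Suc unfolding K_def X_def u_def .
  ultimately have "K * ((\<Sum>m<Suc M. theta_kernel q (Suc k) m) - (\<Sum>m<Suc (Suc M). theta_kernel q k m))
      = (1 + K) * ((1 - q * X) * v)"
    by (simp only: right_diff_distrib) simp
  then show ?case unfolding p(4) K_def v_def .
qed

text \<open>Since (q)_n has a nonzero limit, it and its reciprocal are bounded, which controls all
  three q-factorials uniformly in k; the exponent of q is at least m.\<close>

lemma theta_kernel_bound: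
  assumes "norm q < 1"
  obtains C where "\<And>k m. norm (theta_kernel q k m) \<le> C * norm q ^ m"
proof -
  obtain L where L: "qpoch q q \<longlonglongrightarrow> L" "L \<noteq> 0"
    using qpoch_self_tendsto[OF assms] .
  obtain A where A: "A > 0" "\<And>n. norm (qpoch q q n) \<le> A"
    using convergent_imp_Bseq[OF convergentI[OF L(1)]] by (auto simp: Bseq_def)
  obtain B where B: "B > 0" "\<And>n. norm (inverse (qpoch q q n)) \<le> B"
    using convergent_imp_Bseq[OF convergentI[OF tendsto_inverse[OF L]]] by (auto simp: Bseq_def)
  have "norm (theta_kernel q k m) \<le> (A * B * B) * norm q ^ m" for k m
  proof -
    have "m \<le> Suc m choose 2" by (simp add: choose_two_Suc)
    then have "norm q ^ (k * m + (Suc m choose 2)) \<le> norm q ^ m"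
      using assms by (intro power_decreasing) auto
    moreover have "theta_kernel q k m = (-1) ^ m * q ^ (k * m + (Suc m choose 2)) * (qpoch q q (k + m)
        * inverse (qpoch q q (2 * k + 1 + m)) * inverse (qpoch q q m))"
      by (simp add: theta_kernel_def divide_inverse)
    then have "norm (theta_kernel q k m) = norm q ^ (k * m + (Suc m choose 2)) *
       (norm (qpoch q q (k + m)) * norm (inverse (qpoch q q (2 * k + 1 + m))) * norm (inverse (qpoch q q m)))"
      by (simp only: norm_mult norm_power) simp
    moreover have "norm (qpoch q q (k + m)) * norm (inverse (qpoch q q (2 * k + 1 + m)))
        * norm (inverse (qpoch q q m)) \<le> A * B * B"
      using A B by (intro mult_mono) auto
    ultimately show ?thesis
      using A B by (simp only: mult.commute[of "A * B * B"]) (intro mult_mono; simp)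
  qed
  then show ?thesis by (rule that)
qed

text \<open>As M grows the certificate in \<open>theta_kernel_telescope\<close> tends to 0, so
  consecutive k have equal sums after division by q^(k+1). That division forces the separate case q
  = 0, where only m = 0 contributes.\<close>

lemma theta_kernel_sums:
  assumes "norm q < 1"
  shows "theta_kernel q k sums 1"
proof (cases "q = 0")
  case True
  have "theta_kernel q k m = (if m = 0 then 1 else 0)" for m
    using True by (cases m) (simp_all add: theta_kernel_def qpoch_zero_base binomial_eq_0 choose_two_Suc)
  then have "theta_kernel q k = (\<lambda>m. if m = 0 then 1 else 0)" by blast
  then show ?thesis using sums_single[of 0 "\<lambda>_. 1 :: complex"] by simp
next
  case False
  obtain C where C: "\<And>k m. norm (theta_kernel q k m) \<le> C * norm q ^ m"
    using theta_kernel_bound[OF assms] by blast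
  have sm: "summable (theta_kernel q k)" for k
    by (rule summable_comparison_test'[OF summable_mult[OF summable_geometric] C]) (use assms in simp)
  have pow: "(\<lambda>n. q ^ n) \<longlonglongrightarrow> 0" using assms by (rule LIMSEQ_power_zero)
  show ?thesis
  proof (induction k)
    case 0
    obtain L where L: "qpoch q q \<longlonglongrightarrow> L" "L \<noteq> 0"
      using qpoch_self_tendsto[OF assms] .
    have "(\<lambda>M. norm q ^ M) \<longlonglongrightarrow> 0" using assms by (intro LIMSEQ_power_zero) simp
    then have "(\<lambda>M. (-1) ^ M * q ^ (Suc M choose 2)) \<longlonglongrightarrow> 0"
    proof (rule Lim_null_comparison[rotated], intro always_eventually allI)
      fix M
      have "M \<le> Suc M choose 2" by (simp add: choose_two_Suc)
      then show "norm ((-1) ^ M * q ^ (Suc M choose 2)) \<le> norm q ^ M"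
        using assms by (simp add: norm_mult norm_power power_decreasing)
    qed
    from tendsto_diff[OF tendsto_const tendsto_divide[OF this L], of 1]
    show ?case
      unfolding sums_def theta_kernel_0_partial_sum[OF assms] by simp
  next
    case (Suc k)
    let ?S = "suminf (theta_kernel q (Suc k))"
    have "(\<lambda>M. q ^ Suc k * ((\<Sum>m<M. theta_kernel q (Suc k) m) - (\<Sum>m<Suc M. theta_kernel q k m)))
       \<longlonglongrightarrow> q ^ Suc k * (?S - 1)"
      using summable_LIMSEQ[OF sm[of "Suc k"]] LIMSEQ_Suc[OF Suc[unfolded sums_def]]
      by (intro tendsto_intros)
    moreover have "(\<lambda>M. (1 + q ^ Suc k) * ((1 - q ^ Suc M) * theta_kernel q k (Suc M)))
       \<longlonglongrightarrow> (1 + q ^ Suc k) * ((1 - 0) * 0)"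
      using LIMSEQ_Suc[OF pow] LIMSEQ_Suc[OF summable_LIMSEQ_zero[OF sm[of k]]]
      by (intro tendsto_intros)
    ultimately have "q ^ Suc k * (?S - 1) = (1 + q ^ Suc k) * ((1 - 0) * 0)"
      unfolding theta_kernel_telescope[OF assms] by (rule LIMSEQ_unique)
    then have "?S = 1" using False by simp
    then show ?case using summable_sums[OF sm[of "Suc k"]] by simp
  qed
qed

section \<open>Interchange of summation over a triangle\<close>

text \<open>Cut off at n = N, the triangle regroups into the b_k times partial sums of t_k up to N -
  k. These converge for fixed k and are dominated by |b_k| B, so Tannery's theorem applies.\<close>

lemma sums_triangle:
  fixes b :: "nat \<Rightarrow> 'a :: {real_normed_algebra, banach}"
  assumes b: "summable (\<lambda>k. norm (b k))"
    and s: "\<And>k. t k sums s k"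
    and B: "\<And>k N. norm (\<Sum>m\<le>N. t k m) \<le> B"
  shows "(\<lambda>n. \<Sum>k\<le>n. b k * t k (n - k)) sums (\<Sum>k. b k * s k)"
proof -
  \<comment> \<open>The value 0 for k > N makes the finite sum over k a full series, as Tannery's
    theorem requires.\<close>
  define a where "a = (\<lambda>k N. if k \<le> N then b k * (\<Sum>m\<le>N - k. t k m) else 0)"
  have "(\<lambda>N. \<Sum>k. a k N) \<longlonglongrightarrow> (\<Sum>k. b k * s k)"
  proof (rule tannerys_theorem[THEN conjunct2, THEN conjunct2])
    fix k
    \<comment> \<open>Shifting N by k removes both the case distinction and the truncated
      subtraction N - k.\<close>
    have "(\<lambda>N. a k (N + k)) \<longlonglongrightarrow> b k * s k"
      using s[of k] unfolding a_def by (auto simp: sums_def_le intro!: tendsto_intros)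
    then show "a k \<longlonglongrightarrow> b k * s k" by (rule LIMSEQ_offset)
  next
    have B0: "B \<ge> 0" using B[of 0 0] norm_ge_zero order_trans by blast
    have "norm (a k N) \<le> norm (b k) * B" for k N
      using B0 B[of k "N - k"] unfolding a_def
      by (auto intro!: order_trans[OF norm_mult_ineq] mult_left_mono)
    then show "\<forall>\<^sub>F (k, N) in at_top \<times>\<^sub>F sequentially. norm (a k N) \<le> norm (b k) * B"
      by (intro always_eventually) auto
    show "summable (\<lambda>k. norm (b k) * B)" using b by (rule summable_mult2)
  qed simp
  moreover have "(\<Sum>k. a k N) = (\<Sum>n\<le>N. \<Sum>k\<le>n. b k * t k (n - k))" for N
  proof -
    have "(\<Sum>n\<le>N. \<Sum>k\<le>n. b k * t k (n - k)) = (\<Sum>(k, m)\<in>{(k, m). k + m \<le> N}. b k * t k m)"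
      by (rule sum.triangle_reindex_eq[symmetric])
    also have "{(k, m). k + m \<le> N} = Sigma {..N} (\<lambda>k. {..N - k})" by auto
    also have "(\<Sum>(k, m)\<in>\<dots>. b k * t k m) = (\<Sum>k\<le>N. a k N)"
      by (subst sum.Sigma[symmetric]) (auto simp: a_def sum_distrib_left)
    also have "\<dots> = (\<Sum>k. a k N)"
      by (rule suminf_finite[symmetric]) (auto simp: a_def)
    finally show ?thesis by simp
  qed
  ultimately show ?thesis by (simp add: sums_def_le)
qed

section \<open>Partial theta series and conclusion\<close>

lemma summable_norm_partial_theta:
  fixes q z :: complex
  assumes "norm q < 1"
  shows "summable (\<lambda>k. norm (q ^ (k * (k + 1)) * z ^ k))"
proof -
  \<comment> \<open>The ratio of consecutive terms is |q|^(2(k+1)) |z|; the larger quantity |q|^k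
    |z| is eventually below 1/2.\<close>
  have "(\<lambda>k. norm q ^ k) \<longlonglongrightarrow> 0" using assms by (intro LIMSEQ_power_zero) simp
  then have "(\<lambda>k. norm q ^ k * norm z) \<longlonglongrightarrow> 0" by (rule tendsto_mult_left_zero)
  then have "\<forall>\<^sub>F k in sequentially. norm q ^ k * norm z < 1 / 2"
    by (rule order_tendstoD) simp
  then obtain N where N: "\<And>k. k \<ge> N \<Longrightarrow> norm q ^ k * norm z < 1 / 2"
    by (auto simp: eventually_sequentially)
  show ?thesis
  proof (rule summable_ratio_test[of "1/2" N])
    fix k assume k: "k \<ge> N"
    have "norm q ^ (2 * (k + 1)) * norm z \<le> norm q ^ k * norm z"
      using assms by (intro mult_right_mono power_decreasing) auto
    also note N[OF k]
    finally have le: "norm q ^ (2 * (k + 1)) * norm z \<le> 1 / 2" by simp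
    have "Suc k * (Suc k + 1) = 2 * (k + 1) + k * (k + 1)" by simp
    then have "norm (norm (q ^ (Suc k * (Suc k + 1)) * z ^ Suc k))
       = (norm q ^ (2 * (k + 1)) * norm z) * norm (norm (q ^ (k * (k + 1)) * z ^ k))"
      by (simp only: power_add norm_mult norm_power power_Suc mult_ac) simp
    also have "\<dots> \<le> 1 / 2 * norm (norm (q ^ (k * (k + 1)) * z ^ k))"
      by (intro mult_right_mono le) simp
    finally show "norm (norm (q ^ (Suc k * (Suc k + 1)) * z ^ Suc k))
        \<le> 1 / 2 * norm (norm (q ^ (k * (k + 1)) * z ^ k))" .
  qed simp
qed

text \<open>The product n(n+1) is invariant under n -> -1-n, while the sign (-1)^n flips. Hence
  subtracting the sum over negative n adds the terms with z^(-1-k).\<close>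

lemma neg_theta_term:
  fixes q z :: complex
  shows "(-1) powi (- 1 - int k) * q powi ((- 1 - int k) * ((- 1 - int k) + 1)) * z powi (- 1 - int k)
    = - ((-1) ^ k * q ^ (k * (k + 1)) * inverse z ^ Suc k)"
proof -
  have e: "- 1 - int k = - int (Suc k)" "(- 1 - int k) * ((- 1 - int k) + 1) = int (k * (k + 1))"
    by (simp_all add: algebra_simps)
  show ?thesis
    unfolding e(2) power_int_of_nat unfolding e(1) power_int_minus power_int_of_nat
    by (simp flip: power_inverse)
qed

theorem theorem3p3:
  fixes q z :: complex
  assumes "norm q < 1" and "z \<noteq> 0"
  shows "summable (\<lambda>n::nat. (-1) ^ n * (qpoch (-1 / z) q (n + 1) * qpoch2 (-z * q) q q n
             / qpoch q q (2 * n + 1)) * q ^ ((n + 1) choose 2))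
    \<and> summable (\<lambda>n::nat. (-1) ^ n * q ^ (n * (n + 1)) * z ^ n)
    \<and> (\<lambda>n::int. (-1) powi n * q powi (n * (n + 1)) * z powi n) summable_on {..-1}
    \<and> (\<Sum>n::nat. (-1) ^ n * (qpoch (-1 / z) q (n + 1) * qpoch2 (-z * q) q q n
             / qpoch q q (2 * n + 1)) * q ^ ((n + 1) choose 2))
      = (\<Sum>n::nat. (-1) ^ n * q ^ (n * (n + 1)) * z ^ n)
        - (\<Sum>\<^sub>\<infinity>n\<in>{..-1::int}. (-1) powi n * q powi (n * (n + 1)) * z powi n)"
proof -
  \<comment> \<open>The two halves of b_k = f k + g k, giving the sum over n >= 0 and, up to sign,
    the sum over n < 0.\<close>
  define f where "f = (\<lambda>k. (-1) ^ k * q ^ (k * (k + 1)) * z ^ k)"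
  define g where "g = (\<lambda>k. (-1) ^ k * q ^ (k * (k + 1)) * inverse z ^ Suc k)"
  define h where "h = (\<lambda>n::int. (-1) powi n * q powi (n * (n + 1)) * z powi n)"
  have f: "summable (\<lambda>k. norm (f k))"
    using summable_norm_partial_theta[OF assms(1), of z] by (simp add: f_def norm_mult norm_power)
  have "norm (g k) = norm (inverse z) * norm (q ^ (k * (k + 1)) * inverse z ^ k)" for k
    by (simp add: g_def norm_mult norm_power)
  then have g: "summable (\<lambda>k. norm (g k))"
    by (simp only: summable_mult summable_norm_partial_theta[OF assms(1)])
  have fg: "summable (\<lambda>k. norm (f k + g k))"
    by (rule summable_comparison_test'[OF summable_add[OF f g], of 0]) (simp add: norm_triangle_ineq)
  have "bij_betw (\<lambda>k. - 1 - int k) UNIV {..-1}"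
    by (rule bij_betwI[of _ _ _ "\<lambda>n. nat (- 1 - n)"]) auto
  moreover have "((\<lambda>k. h (- 1 - int k)) has_sum - suminf g) UNIV"
    unfolding h_def neg_theta_term g_def[symmetric]
    using norm_summable_imp_has_sum[OF g summable_sums[OF summable_norm_cancel[OF g]]]
    by (simp add: has_sum_uminus g_def)
  ultimately have h: "(h has_sum - suminf g) {..-1}"
    by (rule has_sum_reindex_bij_betw[THEN iffD1])
  obtain C where C: "\<And>k m. norm (theta_kernel q k m) \<le> C * norm q ^ m"
    using theta_kernel_bound[OF assms(1)] by blast
  have gs: "summable (\<lambda>m. C * norm q ^ m)"
    using assms(1) by (intro summable_mult summable_geometric) simp
  \<comment> \<open>The full geometric majorant bounds every partial sum of every kernel, which
    supplies the constant B of \<open>sums_triangle\<close>.\<close>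
  have "norm (\<Sum>m\<le>N. theta_kernel q k m) \<le> (\<Sum>m. C * norm q ^ m)" for k N
  proof -
    have "norm (\<Sum>m\<le>N. theta_kernel q k m) \<le> (\<Sum>m\<le>N. C * norm q ^ m)"
      by (rule sum_norm_le) (rule C)
    also have "\<dots> \<le> (\<Sum>m. C * norm q ^ m)"
      by (rule sum_le_suminf[OF gs]) (auto intro: order_trans[OF norm_ge_zero C])
    finally show ?thesis .
  qed
  from sums_triangle[OF fg theta_kernel_sums[OF assms(1)] this]
  have "(\<lambda>n. \<Sum>k\<le>n. (f k + g k) * theta_kernel q k (n - k)) sums (\<Sum>k. f k + g k)"
    by simp
  also have "(\<Sum>k. f k + g k) = suminf f + suminf g"
    by (rule suminf_add[OF summable_norm_cancel[OF f] summable_norm_cancel[OF g], symmetric])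
  also have "(\<lambda>n. \<Sum>k\<le>n. (f k + g k) * theta_kernel q k (n - k))
     = (\<lambda>n. (-1) ^ n * (qpoch (-1 / z) q (n + 1) * qpoch2 (-z * q) q q n
             / qpoch q q (2 * n + 1)) * q ^ ((n + 1) choose 2))"
    unfolding summand_eq[OF assms] f_def g_def by (simp only: distrib_left)
  finally have sums: "\<dots> sums (suminf f + suminf g)" .
  show ?thesis
    using summable_norm_cancel[OF f] sums_summable[OF sums] sums_unique[OF sums, symmetric]
      has_sum_imp_summable[OF h] infsumI[OF h]
    unfolding f_def[symmetric] h_def[symmetric] by simp
qed

end
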